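(* Let $\mathbb{K}\in\{\mathbb{R},\mathbb{C}\}$, let $A:\mathbb{K}^N\otimes\mathbb{K}^n\to\mathbb{K}^m$ be a linear operator with block-operators $A_1,\dots,A_N\in\mathbb{K}^{m\times n}$, and let $s\in\{1,\dots,N\}$, $\sigma\in\{1,\dots,n\}$. Then: 1. $\sup_i\delta_\sigma(A_i)\le\delta_{1,\sigma}(A)$ and $\mu_{\mathrm{block}}^{\sigma\sigma}(A)\le 2\,\delta_{2,\sigma}(A)$. 2. $\delta_{s,\sigma}(A)\le\sup_i\delta_\sigma(A_i)+(s-1)\,\mu_{\mathrm{block}}^{\sigma\sigma}(A)$. In addition, if all columns of all the block-operators $A_i$ are normalized (have Euclidean norm $1$), then $$\delta_{s,\sigma}(A)\le(\sigma-1)\,\nu(A)+(s-1)\,\mu_{\mathrm{block}}^{\sigma\sigma}(A).$$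
   Context: Let $\|\cdot\|$ be the Euclidean norm and $e_1,\dots,e_N$ the standard basis of $\mathbb{K}^N$. A vector $x\in\mathbb{K}^N\otimes\mathbb{K}^n\cong\mathbb{K}^{Nn}$ with blocks $x_1,\dots,x_N\in\mathbb{K}^n$ is written $x=\sum_{i=1}^N e_i\otimes x_i$. It is $(s,\sigma)$-sparse if at most $s$ of the blocks are non-zero and each non-zero block has at most $\sigma$ non-zero entries. The block-operators $A_i\in\mathbb{K}^{m\times n}$ of $A$ are defined by $A_iv=A(e_i\otimes v)$ for $v\in\mathbb{K}^n$, so $Ax=\sum_iA_ix_i$. For a matrix $B$ with $n$ columns, $\delta_\sigma(B)$ is the smallest $\delta\ge0$ with $(1-\delta)\|v\|^2\le\|Bv\|^2\le(1+\delta)\|v\|^2$ for all $\sigma$-sparse $v\in\mathbb{K}^n$ (at most $\sigma$ non-zero entries). Similarly, $\delta_{s,\sigma}(A)$ is the smallest $\delta\ge0$ with $(1-\delta)\|x\|^2\le\|Ax\|^2\le(1+\delta)\|x\|^2$ for all $(s,\sigma)$-sparse $x$. Let $a_{i,1},\dots,a_{i,n}$ be the columns of $A_i$. The sub-coherence of $A$ is $\nu(A)=\sup_i\sup_{j\ne k}|\langle a_{i,j},a_{i,k}\rangle|$. The sparse block-coherence of $A$ is $\mu_{\mathrm{block}}^{\sigma\sigma}(A)=\sup_{i\ne j}\rho^{\sigma\sigma}(A_i^*A_j)$, where for $B\in\mathbb{K}^{n\times n}$ $$\rho^{\sigma\sigma}(B)=\sup\{|\langle u,Bv\rangle| : u,v\in\mathbb{K}^n\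 \sigma\text{-sparse},\ \|u\|=\|v\|=1\}.$$ Suprema over empty index sets are $0$. *)

theory Defs
  imports "HOL-Analysis.Analysis"
begin

text \<open>
  The scalar fields. The last axiom determines \<open>kconj\<close>, and a real normed field is isomorphic to
  the reals or the complex numbers (Gelfand-Mazur), so quantifying over this class is quantifying
  over \<open>\<real>\<close> and \<open>\<complex>\<close>.
\<close>

class real_or_complex = real_normed_field +
  fixes kconj :: "'a \<Rightarrow> 'a"
  assumes kconj_add: "kconj (x + y) = kconj x + kconj y"
    and kconj_mult: "kconj (x * y) = kconj x * kconj y"
    and kconj_kconj: "kconj (kconj x) = x"
    and mult_kconj: "x * kconj x = (norm x)\<^sup>2 *\<^sub>R 1"

instantiation real :: real_or_complex
begin

definition kconj_real :: "real \<Rightarrow> real" where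
  "kconj_real x = x"

instance
  by standard (simp_all add: kconj_real_def power2_eq_square)

end

instantiation complex :: real_or_complex
begin

definition kconj_complex :: "complex \<Rightarrow> complex" where
  "kconj_complex = cnj"

instance
  by standard
    (simp_all add: kconj_complex_def complex_norm_square scaleR_conv_of_real flip: of_real_power)

end

definition hinner :: "'k::real_or_complex ^ 'n \<Rightarrow> 'k ^ 'n \<Rightarrow> 'k" where
  "hinner u v = (\<Sum>j\<in>UNIV. kconj (u $ j) * v $ j)"

lemma hinner_self: "hinner v v = of_real ((norm v)\<^sup>2)"
proof -
  have "kconj (v $ j) * v $ j = of_real ((norm (v $ j))\<^sup>2)" for j
    using mult_kconj[of "v $ j"] by (simp add: mult.commute of_real_def)
  then show ?thesis
    unfolding hinner_def norm_vec_def L2_set_def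
    by (simp add: sum_nonneg flip: of_real_power)
qed

definition adjoint_matrix :: "'k::real_or_complex ^ 'n ^ 'm \<Rightarrow> 'k ^ 'm ^ 'n" where
  "adjoint_matrix B = (\<chi> j i. kconj (B $ i $ j))"

text \<open>Suprema of sets of nonnegative reals, with value \<open>0\<close> on the empty set.\<close>

definition sup0 :: "real set \<Rightarrow> real" where
  "sup0 S = (if S = {} then 0 else Sup S)"

text \<open>
  \<open>\<bbbK>\<^sup>N \<otimes> \<bbbK>\<^sup>n\<close> is the space of vectors indexed by pairs (block, position in the block).
\<close>

definition tensor :: "'k::real_or_complex ^ 'N \<Rightarrow> 'k ^ 'n \<Rightarrow> 'k ^ ('N::finite \<times> 'n::finite)"
  where "tensor u v = (\<chi> p. u $ fst p * v $ snd p)"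

definition block :: "'k ^ ('N::finite \<times> 'n::finite) \<Rightarrow> 'N \<Rightarrow> 'k ^ 'n" where
  "block x i = (\<chi> j. x $ (i, j))"

lemma sum_tensor_block:
  fixes x :: "'k::real_or_complex ^ ('N::finite \<times> 'n::finite)"
  shows "(\<Sum>i\<in>UNIV. tensor (axis i 1) (block x i)) = x"
  by (simp add: vec_eq_iff tensor_def block_def axis_def if_distrib[of "\<lambda>c. c * _"] cong: if_cong)

definition sparse :: "nat \<Rightarrow> 'k::real_or_complex ^ 'n \<Rightarrow> bool" where
  "sparse \<sigma> v \<longleftrightarrow> card {j. v $ j \<noteq> 0} \<le> \<sigma>"

definition block_sparse :: "nat \<Rightarrow> nat \<Rightarrow> 'k::real_or_complex ^ ('N::finite \<times> 'n::finite) \<Rightarrow> bool" where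
  "block_sparse s \<sigma> x \<longleftrightarrow>
     card {i. block x i \<noteq> 0} \<le> s \<and> (\<forall>i. block x i \<noteq> 0 \<longrightarrow> sparse \<sigma> (block x i))"

definition block_op ::
    "('k::real_or_complex ^ ('N::finite \<times> 'n::finite) \<Rightarrow> 'k ^ 'm) \<Rightarrow> 'N \<Rightarrow> 'k ^ 'n ^ 'm" where
  "block_op A i = matrix (\<lambda>v. A (tensor (axis i 1) v))"

definition restricted_isometry_const ::
    "'a::real_normed_vector set \<Rightarrow> ('a \<Rightarrow> 'b::real_normed_vector) \<Rightarrow> real" where
  "restricted_isometry_const S f =
     (LEAST \<delta>. 0 \<le> \<delta> \<and>
        (\<forall>x\<in>S. (1 - \<delta>) * (norm x)\<^sup>2 \<le> (norm (f x))\<^sup>2 \<and> (norm (f x))\<^sup>2 \<le> (1 + \<delta>) * (norm x)\<^sup>2))"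

lemma restricted_isometry_const_le_iff:
  assumes "bounded_linear f" and "0 \<le> \<delta>"
  shows "restricted_isometry_const S f \<le> \<delta> \<longleftrightarrow>
    (\<forall>x\<in>S. (1 - \<delta>) * (norm x)\<^sup>2 \<le> (norm (f x))\<^sup>2 \<and> (norm (f x))\<^sup>2 \<le> (1 + \<delta>) * (norm x)\<^sup>2)"
proof -
  define P where "P d \<longleftrightarrow> 0 \<le> d \<and> (\<forall>x\<in>S. (1 - d) * (norm x)\<^sup>2 \<le> (norm (f x))\<^sup>2 \<and>
    (norm (f x))\<^sup>2 \<le> (1 + d) * (norm x)\<^sup>2)" for d
  obtain K where K: "norm (f x) \<le> norm x * K" for x
    using bounded_linear.bounded[OF assms(1)] by blast
  have up: "P e" if "P d" "d \<le> e" for d e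
  proof -
    have "(1 - e) * (norm x)\<^sup>2 \<le> (1 - d) * (norm x)\<^sup>2" "(1 + d) * (norm x)\<^sup>2 \<le> (1 + e) * (norm x)\<^sup>2" for x :: 'a
      using that(2) by (auto intro!: mult_right_mono)
    then show ?thesis
      using that unfolding P_def by (meson order_trans)
  qed
  have "P (1 + K\<^sup>2)"
  proof -
    have "(norm (f x))\<^sup>2 \<le> (1 + (1 + K\<^sup>2)) * (norm x)\<^sup>2" for x
    proof -
      have "(norm (f x))\<^sup>2 \<le> (norm x * K)\<^sup>2"
        using K by (intro power_mono) auto
      also have "\<dots> \<le> (1 + (1 + K\<^sup>2)) * (norm x)\<^sup>2"
        by (simp add: algebra_simps power_mult_distrib)
      finally show ?thesis .
    qed
    moreover have "(1 - (1 + K\<^sup>2)) * (norm x)\<^sup>2 \<le> (norm (f x))\<^sup>2" for x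
    proof -
      have "(1 - (1 + K\<^sup>2)) * (norm x)\<^sup>2 \<le> 0"
        by simp
      then show ?thesis
        by (rule order_trans) simp
    qed
    ultimately show ?thesis
      unfolding P_def by simp
  qed
  then have ne: "Collect P \<noteq> {}" by blast
  have bdd: "bdd_below (Collect P)"
    unfolding bdd_below_def P_def by blast
  have "closed (Collect P)"
    unfolding P_def Collect_conj_eq Collect_ball_eq
    by (intro closed_Int closed_INT ballI closed_Collect_le continuous_intros)
  then have "P (Inf (Collect P))"
    using closed_contains_Inf[OF ne bdd] by blast
  moreover have "Inf (Collect P) \<le> d" if "P d" for d
    using cInf_lower[OF _ bdd] that by blast
  ultimately have inf: "P (Inf (Collect P))" "\<And>d. P d \<Longrightarrow> Inf (Collect P) \<le> d"
    by blast+
  then have eq: "Least P = Inf (Collect P)"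
    by (rule Least_equality)
  have "restricted_isometry_const S f = Least P"
    by (simp add: restricted_isometry_const_def P_def [abs_def])
  then have "restricted_isometry_const S f \<le> \<delta> \<longleftrightarrow> P \<delta>"
    using inf(2)[of \<delta>] up[OF inf(1), of \<delta>] by (auto simp only: eq)
  then show ?thesis
    using assms(2) by (simp add: P_def)
qed

definition delta :: "nat \<Rightarrow> 'k::real_or_complex ^ 'n ^ 'm \<Rightarrow> real" where
  "delta \<sigma> B = restricted_isometry_const {v. sparse \<sigma> v} (\<lambda>v. B *v v)"

definition block_delta ::
    "nat \<Rightarrow> nat \<Rightarrow> ('k::real_or_complex ^ ('N::finite \<times> 'n::finite) \<Rightarrow> 'k ^ 'm) \<Rightarrow> real" where
  "block_delta s \<sigma> A = restricted_isometry_const {x. block_sparse s \<sigma> x} A"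

definition sub_coherence ::
    "('k::real_or_complex ^ ('N::finite \<times> 'n::finite) \<Rightarrow> 'k ^ 'm) \<Rightarrow> real" where
  "sub_coherence A =
     sup0 (range (\<lambda>i. sup0 {norm (hinner (column j (block_op A i)) (column k (block_op A i)))
                            | j k. j \<noteq> k}))"

definition sparse_radius :: "nat \<Rightarrow> 'k::real_or_complex ^ 'n ^ 'n \<Rightarrow> real" where
  "sparse_radius \<sigma> B =
     sup0 {norm (hinner u (B *v v)) | u v.
             sparse \<sigma> u \<and> sparse \<sigma> v \<and> norm u = 1 \<and> norm v = 1}"

definition sparse_block_coherence ::
    "nat \<Rightarrow> ('k::real_or_complex ^ ('N::finite \<times> 'n::finite) \<Rightarrow> 'k ^ 'm) \<Rightarrow> real" where
  "sparse_block_coherence \<sigma> A =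
     sup0 {sparse_radius \<sigma> (adjoint_matrix (block_op A i) ** block_op A j) | i j. i \<noteq> j}"

end

theory Submission
  imports Defs
begin

text \<open>
  If \<open>\<bar>\<langle>w\<^sub>i, w\<^sub>j\<rangle>\<bar> \<le> \<mu> a\<^sub>i a\<^sub>j\<close> for \<open>i \<noteq> j\<close> and at most \<open>s\<close> of the weights \<open>a\<^sub>i\<close> are non-zero, then
  \<open>\<parallel>\<Sum> w\<^sub>i\<parallel>\<^sup>2\<close> differs from \<open>\<Sum> \<parallel>w\<^sub>i\<parallel>\<^sup>2\<close> by at most \<open>(s - 1) \<mu> \<Sum> a\<^sub>i\<^sup>2\<close>, by Cauchy-Schwarz.
  With \<open>w\<^sub>i = A\<^sub>i x\<^sub>i\<close> this yields the bound on \<open>\<delta>\<^sub>s\<^sub>,\<^sub>\<sigma>(A)\<close>; with the scaled columns of a single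
  block it bounds \<open>\<delta>\<^sub>\<sigma>(A\<^sub>i)\<close> by the sub-coherence. The estimate of the block-coherence is a
  polarization argument, which even gives \<open>\<delta>\<^sub>2\<^sub>,\<^sub>\<sigma>(A)\<close> without the factor \<open>2\<close>.
\<close>

section \<open>Conjugation and the sesquilinear form\<close>

lemma kconj_0 [simp]: "kconj 0 = (0 :: 'k::real_or_complex)"
  using kconj_add[of 0 "0 :: 'k"] by simp

lemma norm_kconj [simp]: "norm (kconj x) = norm (x :: 'k::real_or_complex)"
proof (cases "x = 0")
  case False
  have "norm x * norm (kconj x) = norm x * norm x"
    using mult_kconj[of x] by (simp add: power2_eq_square flip: norm_mult)
  then show ?thesis
    using False by simp
qed simp

text \<open>By \<open>mult_kconj\<close> and the norm of a real scalar, r times its conjugate is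
  r^2. Cancelling r leaves the claim; r = 0 is separate.\<close>

lemma kconj_of_real [simp]: "kconj (of_real r) = (of_real r :: 'k::real_or_complex)"
proof (cases "r = 0")
  case False
  have "of_real r * kconj (of_real r) = (of_real r * of_real r :: 'k)"
    using mult_kconj[of "of_real r :: 'k"]
    by (simp add: power2_eq_square scaleR_conv_of_real)
  then show ?thesis
    using False by simp
qed simp

lemma kconj_sum: "kconj (sum f S) = (\<Sum>i\<in>S. kconj (f i :: 'k::real_or_complex))"
  by (induction S rule: infinite_finite_induct) (simp_all add: kconj_add)

lemma kconj_mult_self: "kconj x * x = of_real ((norm (x :: 'k::real_or_complex))\<^sup>2)"
  using mult_kconj[of x] by (simp add: mult.commute of_real_def)

lemma hinner_add_left: "hinner (u + u') v = hinner u v + hinner u' v"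
  by (simp add: hinner_def kconj_add distrib_right sum.distrib)

lemma hinner_add_right: "hinner u (v + v') = hinner u v + hinner u v'"
  by (simp add: hinner_def distrib_left sum.distrib)

lemma hinner_scale_left: "hinner (c *s u) v = kconj c * hinner u v"
  by (simp add: hinner_def kconj_mult sum_distrib_left mult.assoc)

lemma hinner_scale_right: "hinner u (c *s v) = c * hinner u v"
  by (simp add: hinner_def sum_distrib_left mult_ac)

lemma hinner_zero [simp]: "hinner 0 v = 0" "hinner v 0 = 0"
  by (simp_all add: hinner_def)

lemma hinner_sum_left: "hinner (sum f S) v = (\<Sum>i\<in>S. hinner (f i) v)"
  by (induction S rule: infinite_finite_induct) (simp_all add: hinner_add_left)

lemma hinner_sum_right: "hinner v (sum f S) = (\<Sum>i\<in>S. hinner v (f i))"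
  by (induction S rule: infinite_finite_induct) (simp_all add: hinner_add_right)

lemma kconj_hinner: "kconj (hinner u v) = hinner v u"
  by (simp add: hinner_def kconj_sum kconj_mult kconj_kconj mult.commute)

lemma norm_hinner_le: "norm (hinner u v) \<le> norm u * norm v"
proof -
  have "norm (hinner u v) \<le> (\<Sum>j\<in>UNIV. \<bar>norm (u $ j)\<bar> * \<bar>norm (v $ j)\<bar>)"
    unfolding hinner_def by (rule order_trans[OF norm_sum]) (simp add: norm_mult)
  also have "\<dots> \<le> norm u * norm v"
    unfolding norm_vec_def by (rule L2_set_mult_ineq)
  finally show ?thesis .
qed

lemma hinner_adjoint_matrix: "hinner u (adjoint_matrix B *v w) = hinner (B *v u) w"
proof -
  have "hinner u (adjoint_matrix B *v w) = (\<Sum>j\<in>UNIV. \<Sum>i\<in>UNIV. kconj (u $ j) * (kconj (B $ i $ j) * w $ i))"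
    by (simp add: hinner_def adjoint_matrix_def matrix_vector_mult_def sum_distrib_left)
  also have "\<dots> = (\<Sum>i\<in>UNIV. \<Sum>j\<in>UNIV. kconj (u $ j) * (kconj (B $ i $ j) * w $ i))"
    by (rule sum.swap)
  also have "\<dots> = hinner (B *v u) w"
    by (simp add: hinner_def matrix_vector_mult_def kconj_sum kconj_mult sum_distrib_left
        sum_distrib_right mult_ac)
  finally show ?thesis .
qed

text \<open>Turns the sparse radius of a product of block-operators into a bound on inner products
  of images, the form used below.\<close>

lemma hinner_gram_matrix: "hinner u ((adjoint_matrix B ** C) *v v) = hinner (B *v u) (C *v v)"
  by (simp add: hinner_adjoint_matrix flip: matrix_vector_mul_assoc)

section \<open>Boundedness of scalar-linear maps\<close>

lemma norm_vector_scale: "norm (c *s v) = norm c * norm (v :: 'k::real_normed_field ^ 'n)"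
  by (simp add: norm_vec_def norm_mult L2_set_right_distrib)

text \<open>Expanding in the standard basis bounds \<open>f\<close> by the sum of the norms of the
  images of the basis vectors. The facts on restricted isometry constants ask for
  \<open>bounded_linear\<close>.\<close>

lemma bounded_linear_if_linear_vec:
  fixes f :: "'k::real_normed_field ^ 'n \<Rightarrow> 'k ^ 'm"
  assumes "Vector_Spaces.linear (*s) (*s) f"
  shows "bounded_linear f"
proof (rule bounded_linear_intro)
  show "f (x + y) = f x + f y" for x y
    by (rule vec.linear_add[OF assms])
  have scaleR: "r *\<^sub>R v = of_real r *s v" for r and v :: "'k ^ 'l"
    unfolding vec_eq_iff vector_scaleR_component vector_smult_component
    by (simp add: scaleR_conv_of_real)
  show "f (r *\<^sub>R x) = r *\<^sub>R f x" for r x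
    unfolding scaleR by (rule vec.linear_scale[OF assms])
  show "norm (f x) \<le> norm x * (\<Sum>p\<in>UNIV. norm (f (axis p 1)))" for x
  proof -
    have "f x = f (\<Sum>p\<in>UNIV. (x $ p) *s axis p 1)"
      by (simp add: basis_expansion)
    also have "\<dots> = (\<Sum>p\<in>UNIV. (x $ p) *s f (axis p 1))"
      by (simp add: vec.linear_sum[OF assms] vec.linear_scale[OF assms])
    finally have "norm (f x) \<le> (\<Sum>p\<in>UNIV. norm (x $ p) * norm (f (axis p 1)))"
      by (simp add: norm_sum flip: norm_vector_scale)
    also have "\<dots> \<le> (\<Sum>p\<in>UNIV. norm x * norm (f (axis p 1)))"
      by (intro sum_mono mult_right_mono Finite_Cartesian_Product.norm_nth_le) auto
    finally show ?thesis
      by (simp add: sum_distrib_left)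
  qed
qed

lemma bounded_linear_matrix_vector_mult:
  "bounded_linear (\<lambda>v. (B :: 'k::real_normed_field ^ 'n ^ 'm) *v v)"
  by (intro bounded_linear_if_linear_vec matrix_vector_mul_linear_gen)

section \<open>Suprema and restricted isometry constants\<close>

lemma sup0_upper: "x \<in> S \<Longrightarrow> bdd_above S \<Longrightarrow> x \<le> sup0 S"
  by (auto simp: sup0_def intro: cSup_upper)

lemma sup0_least: "(\<And>x. x \<in> S \<Longrightarrow> x \<le> b) \<Longrightarrow> 0 \<le> b \<Longrightarrow> sup0 S \<le> b"
  by (auto simp: sup0_def intro: cSup_least)

lemma sup0_nonneg:
  assumes "\<And>x. x \<in> S \<Longrightarrow> 0 \<le> x" and "bdd_above S"
  shows "0 \<le> sup0 S"
proof (cases "S = {}")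
  case False
  then obtain x where "x \<in> S" by blast
  then show ?thesis
    using assms(1) sup0_upper[OF _ assms(2)] by (meson order_trans)
qed (simp add: sup0_def)

text \<open>A negative constant would be at most 0, so 0 would satisfy the inequalities and thus be
  the least admissible value itself, a contradiction.\<close>

lemma restricted_isometry_const_nonneg:
  assumes "bounded_linear f"
  shows "0 \<le> restricted_isometry_const S f"
proof (rule ccontr)
  assume neg: "\<not> 0 \<le> restricted_isometry_const S f"
  then have "\<forall>x\<in>S. (1 - 0) * (norm x)\<^sup>2 \<le> (norm (f x))\<^sup>2 \<and> (norm (f x))\<^sup>2 \<le> (1 + 0) * (norm x)\<^sup>2"
    using restricted_isometry_const_le_iff[OF assms, of 0 S] by simp
  then have "restricted_isometry_const S f = 0"
    unfolding restricted_isometry_const_def by (intro Least_equality) auto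
  then show False
    using neg by simp
qed

text \<open>In this form errors from different sources add up by the triangle inequality.\<close>

lemma restricted_isometry_const_le_iff_abs:
  assumes "bounded_linear f" and "0 \<le> \<delta>"
  shows "restricted_isometry_const S f \<le> \<delta> \<longleftrightarrow>
    (\<forall>x\<in>S. \<bar>(norm (f x))\<^sup>2 - (norm x)\<^sup>2\<bar> \<le> \<delta> * (norm x)\<^sup>2)"
  unfolding restricted_isometry_const_le_iff[OF assms] abs_le_iff by (auto simp: algebra_simps)

lemma abs_restricted_isometry:
  assumes "bounded_linear f" and "x \<in> S"
  shows "\<bar>(norm (f x))\<^sup>2 - (norm x)\<^sup>2\<bar> \<le> restricted_isometry_const S f * (norm x)\<^sup>2"
  using restricted_isometry_const_le_iff_abs[OF assms(1) restricted_isometry_const_nonneg[OF assms(1)]]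
    assms(2) by blast

lemma delta_nonneg: "0 \<le> delta \<sigma> B"
  unfolding delta_def by (intro restricted_isometry_const_nonneg bounded_linear_matrix_vector_mult)

lemma bdd_above_sparse_radius:
  fixes B :: "'k::real_or_complex ^ 'n ^ 'n"
  shows "bdd_above {norm (hinner u (B *v v)) | u v.
    sparse \<sigma> u \<and> sparse \<sigma> v \<and> norm u = 1 \<and> norm v = 1}"
proof -
  obtain K where K: "norm (B *v v) \<le> norm v * K" for v
    using bounded_linear.bounded[OF bounded_linear_matrix_vector_mult[of B]] by blast
  have "norm (hinner u (B *v v)) \<le> K" if "norm u = 1" "norm v = 1" for u v
    using norm_hinner_le[of u "B *v v"] K[of v] that by simp
  then show ?thesis
    unfolding bdd_above_def by blast
qed

lemma sparse_radius_nonneg: "0 \<le> sparse_radius \<sigma> B"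
  unfolding sparse_radius_def by (rule sup0_nonneg[OF _ bdd_above_sparse_radius]) auto

lemma sparse_vector_scale: "sparse \<sigma> v \<Longrightarrow> sparse \<sigma> (c *s v)"
  unfolding sparse_def
  by (rule order_trans[OF card_mono]) auto

text \<open>By homogeneity: scaling both vectors to norm 1 keeps them sparse and places the value in
  the set defining the radius. A zero vector cannot be normalized, but then both sides
  vanish.\<close>

lemma norm_hinner_le_sparse_radius:
  assumes "sparse \<sigma> u" and "sparse \<sigma> v"
  shows "norm (hinner u (B *v v)) \<le> sparse_radius \<sigma> B * (norm u * norm v)"
proof (cases "u = 0 \<or> v = 0")
  case True
  then show ?thesis by auto
next
  case False
  define a where "a = inverse (norm u)"
  define b where "b = inverse (norm v)"
  have ab: "a > 0" "b > 0"
    using False by (auto simp: a_def b_def)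
  have "norm (hinner (of_real a *s u) (B *v (of_real b *s v))) \<le> sparse_radius \<sigma> B"
    unfolding sparse_radius_def
  proof (rule sup0_upper[OF _ bdd_above_sparse_radius])
    have "norm (of_real a *s u) = 1" "norm (of_real b *s v) = 1"
      using False by (simp_all add: norm_vector_scale a_def b_def norm_inverse)
    then show "norm (hinner (of_real a *s u) (B *v (of_real b *s v)))
        \<in> {norm (hinner u (B *v v)) | u v. sparse \<sigma> u \<and> sparse \<sigma> v \<and> norm u = 1 \<and> norm v = 1}"
      using assms by (blast intro: sparse_vector_scale)
  qed
  then have "a * b * norm (hinner u (B *v v)) \<le> sparse_radius \<sigma> B"
    using ab by (simp add: hinner_scale_left hinner_scale_right vec.linear_scale[OF
          matrix_vector_mul_linear_gen] norm_mult mult_ac)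
  then show ?thesis
    using False by (simp add: a_def b_def field_simps)
qed

section \<open>Almost orthogonal families\<close>

text \<open>The full double sum is the square of the sum of the weights, at most s times the sum of
  squares; removing the diagonal gives the -1.\<close>

lemma sum_off_diagonal_le:
  fixes a :: "'i::finite \<Rightarrow> real"
  assumes "card {i. a i \<noteq> 0} \<le> s"
  shows "(\<Sum>i\<in>UNIV. \<Sum>j\<in>-{i}. a i * a j) \<le> (real s - 1) * (\<Sum>i\<in>UNIV. (a i)\<^sup>2)"
proof -
  let ?S = "{i. a i \<noteq> 0}"
  have "(\<Sum>i\<in>UNIV. \<Sum>j\<in>-{i}. a i * a j) = (\<Sum>i\<in>UNIV. a i * sum a UNIV - (a i)\<^sup>2)"
    by (simp add: Compl_eq_Diff_UNIV sum_diff1 power2_eq_square right_diff_distrib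
        flip: sum_distrib_left)
  also have "\<dots> = (sum a UNIV)\<^sup>2 - (\<Sum>i\<in>UNIV. (a i)\<^sup>2)"
    by (simp add: sum_subtractf power2_eq_square flip: sum_distrib_right)
  \<comment> \<open>Restricting to the support first makes Cauchy-Schwarz produce the size of the
    support instead of the size of the index type.\<close>
  also have "sum a UNIV = (\<Sum>i\<in>?S. a i * 1)"
    by (simp add: sum.mono_neutral_right)
  also have "(\<Sum>i\<in>?S. a i * 1)\<^sup>2 \<le> (\<Sum>i\<in>?S. (a i)\<^sup>2) * (\<Sum>i\<in>?S. 1\<^sup>2)"
    by (rule Cauchy_Schwarz_ineq_sum)
  also have "\<dots> = (\<Sum>i\<in>UNIV. (a i)\<^sup>2) * real (card ?S)"
    by (simp add: sum.mono_neutral_left[of UNIV ?S])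
  also have "\<dots> \<le> (\<Sum>i\<in>UNIV. (a i)\<^sup>2) * real s"
    using assms by (intro mult_left_mono sum_nonneg) auto
  finally show ?thesis
    by (simp add: algebra_simps)
qed

lemma norm_sum_almost_orthogonal:
  fixes w :: "'i::finite \<Rightarrow> 'k::real_or_complex ^ 'm::finite"
  assumes "\<And>i j. i \<noteq> j \<Longrightarrow> norm (hinner (w i) (w j)) \<le> \<mu> * (a i * a j)"
    and "card {i. a i \<noteq> 0} \<le> s" and "0 \<le> \<mu>"
  shows "\<bar>(norm (\<Sum>i\<in>UNIV. w i))\<^sup>2 - (\<Sum>i\<in>UNIV. (norm (w i))\<^sup>2)\<bar>
    \<le> (real s - 1) * \<mu> * (\<Sum>i\<in>UNIV. (a i)\<^sup>2)"
proof -
  let ?d = "(norm (\<Sum>i\<in>UNIV. w i))\<^sup>2 - (\<Sum>i\<in>UNIV. (norm (w i))\<^sup>2)"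
  have row: "(\<Sum>j\<in>UNIV. hinner (w i) (w j)) = hinner (w i) (w i) + (\<Sum>j\<in>-{i}. hinner (w i) (w j))" for i
    by (simp add: sum.remove[of UNIV i] Compl_eq_Diff_UNIV)
  have "hinner (sum w UNIV) (sum w UNIV) = (\<Sum>i\<in>UNIV. \<Sum>j\<in>UNIV. hinner (w i) (w j))"
    unfolding hinner_sum_left[of w UNIV] by (simp only: hinner_sum_right)
  \<comment> \<open>The diagonal terms are the squared norms embedded by \<open>of_real\<close>.
    After they cancel, the off-diagonal sum is an embedded real number, whose norm is its absolute
    value.\<close>
  then have "(\<Sum>i\<in>UNIV. \<Sum>j\<in>-{i}. hinner (w i) (w j)) = of_real ?d"
    unfolding of_real_diff of_real_sum hinner_self[symmetric] by (simp only: row sum.distrib) simp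
  then have "\<bar>?d\<bar> = norm (\<Sum>i\<in>UNIV. \<Sum>j\<in>-{i}. hinner (w i) (w j))"
    by (simp only: norm_of_real)
  also have "\<dots> \<le> (\<Sum>i\<in>UNIV. \<Sum>j\<in>-{i}. \<mu> * (a i * a j))"
    by (intro sum_norm_le assms(1)) auto
  also have "\<dots> = \<mu> * (\<Sum>i\<in>UNIV. \<Sum>j\<in>-{i}. a i * a j)"
    by (simp add: sum_distrib_left)
  also have "\<dots> \<le> \<mu> * ((real s - 1) * (\<Sum>i\<in>UNIV. (a i)\<^sup>2))"
    by (intro mult_left_mono sum_off_diagonal_le assms)
  finally show ?thesis
    by (simp add: mult_ac)
qed

section \<open>Blocks\<close>

lemma block_tensor_axis: "block (tensor (axis i 1) v) k = (if k = i then v else 0)"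
  by (simp add: vec_eq_iff block_def tensor_def axis_def)

lemma block_add: "block (x + y) i = block x i + block y i"
  by (simp add: vec_eq_iff block_def)

lemma norm_block: "(norm x)\<^sup>2 = (\<Sum>i\<in>UNIV. (norm (block x i))\<^sup>2)"
  by (simp add: norm_vec_def L2_set_def sum_nonneg block_def sum.cartesian_product)

lemma linear_tensor: "Vector_Spaces.linear (*s) (*s) (tensor u)"
  by unfold_locales (simp_all add: vec_eq_iff tensor_def algebra_simps)

lemma sparse_0 [simp]: "sparse \<sigma> 0"
  by (simp add: sparse_def)

lemma block_sparse_tensor_axis:
  assumes "sparse \<sigma> v"
  shows "block_sparse 1 \<sigma> (tensor (axis i 1) v)"
proof -
  have "card {k. block (tensor (axis i 1) v) k \<noteq> 0} \<le> card {i}"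
    by (intro card_mono) (auto simp: block_tensor_axis)
  then show ?thesis
    using assms by (simp add: block_sparse_def block_tensor_axis)
qed

lemma block_sparse_tensor_axis_add:
  assumes "sparse \<sigma> u" and "sparse \<sigma> v" and "i \<noteq> j"
  shows "block_sparse 2 \<sigma> (tensor (axis i 1) u + tensor (axis j 1) v)"
proof -
  have "card {k. block (tensor (axis i 1) u + tensor (axis j 1) v) k \<noteq> 0} \<le> card {i, j}"
    by (intro card_mono) (auto simp: block_tensor_axis block_add split: if_splits)
  then show ?thesis
    using assms by (auto simp: block_sparse_def block_tensor_axis block_add)
qed

lemma norm_tensor_axis_add:
  assumes "i \<noteq> j"
  shows "(norm (tensor (axis i 1) u + tensor (axis j 1) v))\<^sup>2 = (norm u)\<^sup>2 + (norm v)\<^sup>2"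
proof -
  have "(norm (block (tensor (axis i 1) u + tensor (axis j 1) v) k))\<^sup>2 =
      (if k = i then (norm u)\<^sup>2 else 0) + (if k = j then (norm v)\<^sup>2 else 0)" for k
    using assms by (simp add: block_add block_tensor_axis)
  then show ?thesis
    by (simp add: norm_block sum.distrib)
qed

lemma norm_tensor_axis: "norm (tensor (axis i 1) v) = norm v"
proof -
  have "(norm (tensor (axis i 1) v))\<^sup>2 = (\<Sum>k\<in>UNIV. if k = i then (norm v)\<^sup>2 else 0)"
    unfolding norm_block by (intro sum.cong) (auto simp: block_tensor_axis)
  then show ?thesis
    by simp
qed

lemma norm_hinner_le_sparse_block_coherence:
  assumes "sparse \<sigma> u" and "sparse \<sigma> v" and "i \<noteq> j"
  shows "norm (hinner (block_op A i *v u) (block_op A j *v v))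
    \<le> sparse_block_coherence \<sigma> A * (norm u * norm v)"
proof -
  let ?f = "\<lambda>(i, j). sparse_radius \<sigma> (adjoint_matrix (block_op A i) ** block_op A j)"
  \<comment> \<open>A supremum dominates its members only if the set is bounded above; here the set
    lies in a finite range.\<close>
  have "finite (range ?f)"
    by simp
  then have "bdd_above {sparse_radius \<sigma> (adjoint_matrix (block_op A i) ** block_op A j) | i j. i \<noteq> j}"
    by (rule bdd_above_mono[OF bdd_above_finite]) auto
  then have "?f (i, j) \<le> sparse_block_coherence \<sigma> A"
    unfolding sparse_block_coherence_def using assms(3) by (intro sup0_upper) auto
  then have "?f (i, j) * (norm u * norm v) \<le> sparse_block_coherence \<sigma> A * (norm u * norm v)"
    by (rule mult_right_mono) simp
  then show ?thesis
    using norm_hinner_le_sparse_radius[OF assms(1,2), of "adjoint_matrix (block_op A i) ** block_op A j"]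
    by (simp add: hinner_gram_matrix)
qed

lemma sparse_block_coherence_nonneg: "0 \<le> sparse_block_coherence \<sigma> A"
  unfolding sparse_block_coherence_def
proof (rule sup0_nonneg)
  have "finite (range (\<lambda>(i, j). sparse_radius \<sigma> (adjoint_matrix (block_op A i) ** block_op A j)))"
    by simp
  then show "bdd_above {sparse_radius \<sigma> (adjoint_matrix (block_op A i) ** block_op A j) | i j. i \<noteq> j}"
    by (rule bdd_above_mono[OF bdd_above_finite]) auto
qed (auto simp: sparse_radius_nonneg)

text \<open>Both suprema run over finite sets. The inner one is empty if blocks have length 1, and
  then \<open>sup0\<close> supplies 0; the outer range is never empty, so nonnegativity passes from
  any inner supremum to the outer one.\<close>

lemma
  shows norm_hinner_column_le_sub_coherence:
    "j \<noteq> k \<Longrightarrow> norm (hinner (column j (block_op A i)) (column k (block_op A i))) \<le> sub_coherence A"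
    and sub_coherence_nonneg: "0 \<le> sub_coherence A"
proof -
  let ?f = "\<lambda>i (j, k). norm (hinner (column j (block_op A i)) (column k (block_op A i)))"
  let ?S = "\<lambda>i. {norm (hinner (column j (block_op A i)) (column k (block_op A i))) | j k. j \<noteq> k}"
  have "finite (range (?f i))" for i
    by simp
  then have S: "bdd_above (?S i)" for i
    by (rule bdd_above_mono[OF bdd_above_finite]) auto
  have outer: "sup0 (?S i) \<le> sub_coherence A" for i
    unfolding sub_coherence_def by (intro sup0_upper bdd_above_finite) auto
  have "0 \<le> sup0 (?S i)" for i
    by (rule sup0_nonneg[OF _ S]) auto
  then show "0 \<le> sub_coherence A"
    using outer by (meson order_trans)
  show "norm (hinner (column j (block_op A i)) (column k (block_op A i))) \<le> sub_coherence A" if "j \<noteq> k"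
    using that by (intro order_trans[OF sup0_upper[OF _ S] outer]) auto
qed

section \<open>Restricted isometry constants of a fixed linear operator\<close>

context
  fixes A :: "'k::real_or_complex ^ ('N::finite \<times> 'n::finite) \<Rightarrow> 'k ^ 'm::finite"
  assumes linear_A: "Vector_Spaces.linear (*s) (*s) A"
begin

lemma block_op_mult: "block_op A i *v v = A (tensor (axis i 1) v)"
proof -
  have "Vector_Spaces.linear (*s) (*s) (\<lambda>v. A (tensor (axis i 1) v))"
    using Vector_Spaces.linear_compose[OF linear_tensor linear_A] by (simp add: o_def)
  then show ?thesis
    unfolding block_op_def by (rule matrix_works)
qed

lemma sum_block_op: "A x = (\<Sum>i\<in>UNIV. block_op A i *v block x i)"
proof -
  have "A x = A (\<Sum>i\<in>UNIV. tensor (axis i 1) (block x i))"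
    by (simp add: sum_tensor_block)
  then show ?thesis
    by (simp add: vec.linear_sum[OF linear_A] block_op_mult)
qed

lemma abs_block_delta:
  "block_sparse s \<sigma> x \<Longrightarrow> \<bar>(norm (A x))\<^sup>2 - (norm x)\<^sup>2\<bar> \<le> block_delta s \<sigma> A * (norm x)\<^sup>2"
  unfolding block_delta_def
  by (rule abs_restricted_isometry[OF bounded_linear_if_linear_vec[OF linear_A]]) simp

lemma block_delta_nonneg: "0 \<le> block_delta s \<sigma> A"
  unfolding block_delta_def
  by (rule restricted_isometry_const_nonneg[OF bounded_linear_if_linear_vec[OF linear_A]])

text \<open>Placing a sparse v into block i preserves its norm, gives a single-block vector, and
  \<open>A\<close> maps it to A_i v.\<close>

lemma delta_block_op_le: "delta \<sigma> (block_op A i) \<le> block_delta 1 \<sigma> A"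
  unfolding delta_def restricted_isometry_const_le_iff_abs[OF bounded_linear_matrix_vector_mult
      block_delta_nonneg]
proof clarify
  fix v :: "'k ^ 'n"
  assume "sparse \<sigma> v"
  from abs_block_delta[OF block_sparse_tensor_axis[OF this, of i]]
  show "\<bar>(norm (block_op A i *v v))\<^sup>2 - (norm v)\<^sup>2\<bar> \<le> block_delta 1 \<sigma> A * (norm v)\<^sup>2"
    by (simp add: block_op_mult norm_tensor_axis)
qed

text \<open>
  Polarization: rotating \<open>v\<close> by the phase \<open>c\<close> makes the inner product of the images
  real and nonnegative, so that it is a quarter of the difference of the values of
  \<open>\<parallel>A x\<parallel>\<^sup>2\<close> at the two vectors \<open>e\<^sub>i \<otimes> u \<plusminus> e\<^sub>j \<otimes> c v\<close>.
\<close>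
lemma norm_hinner_le_block_delta:
  assumes "sparse \<sigma> u" and "sparse \<sigma> v" and "norm u = 1" and "norm v = 1" and "i \<noteq> j"
  shows "norm (hinner (block_op A i *v u) (block_op A j *v v)) \<le> block_delta 2 \<sigma> A"
\<comment> \<open>The phase is obtained by dividing by the norm of the inner product, so the value 0
  is treated apart.\<close>
proof (cases "hinner (block_op A i *v u) (block_op A j *v v) = 0")
  case True
  then show ?thesis
    by (simp add: block_delta_nonneg)
next
  case False
  define z where "z = hinner (block_op A i *v u) (block_op A j *v v)"
  define c where "c = kconj z / of_real (norm z)"
  have z: "z \<noteq> 0" and c: "norm c = 1"
    using False by (simp_all add: z_def c_def norm_divide)
  have cz: "c * z = of_real (norm z)"
    using z kconj_mult_self[of z] by (simp add: c_def power2_eq_square)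
  define p where "p = block_op A i *v u"
  define q where "q = block_op A j *v (c *s v)"
  have pq: "hinner p q = of_real (norm z)"
    using cz by (simp add: p_def q_def z_def vec.linear_scale[OF matrix_vector_mul_linear_gen]
        hinner_scale_right)
  have qp: "hinner q p = of_real (norm z)"
    using kconj_hinner[of p q] pq by simp
  \<comment> \<open>A general unit scalar d covers both signs at once. The two blocks have norm 1
    each, hence the squared norm 2 of the test vector.\<close>
  have bound: "\<bar>(norm (p + d *s q))\<^sup>2 - 2\<bar> \<le> block_delta 2 \<sigma> A * 2" if d: "norm d = 1" for d
  proof -
    let ?x = "tensor (axis i 1) u + tensor (axis j 1) ((d * c) *s v)"
    have "p + d *s q = A ?x"
      by (simp add: p_def q_def block_op_mult vec.linear_add[OF linear_A]
          vec.linear_scale[OF linear_A] vec.linear_scale[OF linear_tensor])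
    moreover have "(norm ?x)\<^sup>2 = 2"
      using assms c d by (simp add: norm_tensor_axis_add norm_vector_scale norm_mult)
    moreover have "block_sparse 2 \<sigma> ?x"
      using assms by (intro block_sparse_tensor_axis_add sparse_vector_scale)
    ultimately show ?thesis
      using abs_block_delta[of 2 \<sigma> ?x] by simp
  qed
  have expand: "(norm (p + of_real r *s q))\<^sup>2 = (norm p)\<^sup>2 + 2 * r * norm z + r\<^sup>2 * (norm q)\<^sup>2" for r
  proof -
    have "of_real ((norm (p + of_real r *s q))\<^sup>2) =
        (of_real ((norm p)\<^sup>2 + 2 * r * norm z + r\<^sup>2 * (norm q)\<^sup>2) :: 'k)"
      unfolding of_real_add of_real_mult hinner_self[symmetric]
      by (simp add: hinner_add_left hinner_add_right hinner_scale_left hinner_scale_right pq qp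
          power2_eq_square algebra_simps)
    then show ?thesis
      by (simp only: of_real_eq_iff)
  qed
  \<comment> \<open>Both squared norms lie within twice \<open>block_delta 2 \<sigma> A\<close> of
    2, so their difference is at most four times that constant.\<close>
  have "(norm (p + of_real 1 *s q))\<^sup>2 - (norm (p + of_real (-1) *s q))\<^sup>2 = 4 * norm z"
    unfolding expand by simp
  then have "norm z \<le> block_delta 2 \<sigma> A"
    using bound[of "of_real 1"] bound[of "of_real (-1)"] by simp
  then show ?thesis
    by (simp add: z_def)
qed

lemma sparse_block_coherence_le: "sparse_block_coherence \<sigma> A \<le> block_delta 2 \<sigma> A"
  unfolding sparse_block_coherence_def sparse_radius_def hinner_gram_matrix
  by (auto intro!: sup0_least norm_hinner_le_block_delta block_delta_nonneg)

text \<open>Triangle inequality through the sum of the squared norms of the A_i x_i. The common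
  bound d is a parameter because it is taken once as the supremum of the block constants and once as
  the sub-coherence bound.\<close>

lemma block_delta_le:
  assumes "1 \<le> s" and "0 \<le> d" and "\<And>i. delta \<sigma> (block_op A i) \<le> d"
  shows "block_delta s \<sigma> A \<le> d + (real s - 1) * sparse_block_coherence \<sigma> A"
proof -
  let ?\<mu> = "sparse_block_coherence \<sigma> A"
  have "0 \<le> d + (real s - 1) * ?\<mu>"
    using assms by (simp add: sparse_block_coherence_nonneg)
  moreover have "\<bar>(norm (A x))\<^sup>2 - (norm x)\<^sup>2\<bar> \<le> (d + (real s - 1) * ?\<mu>) * (norm x)\<^sup>2"
    if x: "block_sparse s \<sigma> x" for x
  proof -
    let ?w = "\<lambda>i. block_op A i *v block x i"
    \<comment> \<open>Block sparsity constrains only the non-zero blocks; a zero block is trivially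
      sparse.\<close>
    have sp: "sparse \<sigma> (block x i)" for i
      using x by (cases "block x i = 0") (auto simp: block_sparse_def)
    have "card {i. norm (block x i) \<noteq> 0} \<le> s"
      using x by (simp add: block_sparse_def)
    \<comment> \<open>Interaction between blocks, with the norms of the blocks x_i as
      weights.\<close>
    then have off: "\<bar>(norm (A x))\<^sup>2 - (\<Sum>i\<in>UNIV. (norm (?w i))\<^sup>2)\<bar> \<le> (real s - 1) * ?\<mu> * (norm x)\<^sup>2"
      unfolding sum_block_op[of x] norm_block[of x]
      by (intro norm_sum_almost_orthogonal norm_hinner_le_sparse_block_coherence sp
          sparse_block_coherence_nonneg)
    \<comment> \<open>Distortion within each block, summed over the blocks.\<close>
    have "\<bar>(\<Sum>i\<in>UNIV. (norm (?w i))\<^sup>2) - (norm x)\<^sup>2\<bar>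
        = \<bar>\<Sum>i\<in>UNIV. (norm (?w i))\<^sup>2 - (norm (block x i))\<^sup>2\<bar>"
      by (simp add: norm_block[of x] sum_subtractf)
    also have "\<dots> \<le> (\<Sum>i\<in>UNIV. d * (norm (block x i))\<^sup>2)"
    proof (rule order_trans[OF sum_abs sum_mono])
      fix i
      show "\<bar>(norm (?w i))\<^sup>2 - (norm (block x i))\<^sup>2\<bar> \<le> d * (norm (block x i))\<^sup>2"
        using assms(3)[of i] sp[of i] unfolding delta_def
          restricted_isometry_const_le_iff_abs[OF bounded_linear_matrix_vector_mult assms(2)]
        by simp
    qed
    also have "\<dots> = d * (norm x)\<^sup>2"
      by (simp add: norm_block[of x] sum_distrib_left)
    finally show ?thesis
      using off by (simp add: distrib_right)
  qed
  ultimately show ?thesis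
    unfolding block_delta_def
    using restricted_isometry_const_le_iff_abs[OF bounded_linear_if_linear_vec[OF linear_A]] by blast
qed

end

text \<open>B v is the sum of the columns scaled by the entries of v, an almost orthogonal family
  with weights |v_j|. Since the columns have norm 1, the diagonal part is exactly the squared norm
  of v and adds no error.\<close>

lemma delta_le_coherence:
  fixes B :: "'k::real_or_complex ^ 'n::finite ^ 'm::finite"
  assumes "\<And>j. norm (column j B) = 1"
    and "\<And>j k. j \<noteq> k \<Longrightarrow> norm (hinner (column j B) (column k B)) \<le> \<nu>"
    and "1 \<le> \<sigma>" and "0 \<le> \<nu>"
  shows "delta \<sigma> B \<le> (real \<sigma> - 1) * \<nu>"
proof -
  have "\<bar>(norm (B *v v))\<^sup>2 - (norm v)\<^sup>2\<bar> \<le> (real \<sigma> - 1) * \<nu> * (norm v)\<^sup>2" if "sparse \<sigma> v" for v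
  proof -
    have v: "(norm v)\<^sup>2 = (\<Sum>j\<in>UNIV. (norm (v $ j))\<^sup>2)"
      by (simp add: norm_vec_def L2_set_def sum_nonneg)
    have "norm (hinner (v $ j *s column j B) (v $ k *s column k B)) \<le> \<nu> * (norm (v $ j) * norm (v $ k))"
      if "j \<noteq> k" for j k
    proof -
      have "norm (hinner (v $ j *s column j B) (v $ k *s column k B)) =
          norm (hinner (column j B) (column k B)) * (norm (v $ j) * norm (v $ k))"
        by (simp add: hinner_scale_left hinner_scale_right norm_mult mult_ac)
      also have "\<dots> \<le> \<nu> * (norm (v $ j) * norm (v $ k))"
        by (intro mult_right_mono assms(2) that) simp
      finally show ?thesis .
    qed
    moreover have "card {j. norm (v $ j) \<noteq> 0} \<le> \<sigma>"
      using \<open>sparse \<sigma> v\<close> by (simp add: sparse_def)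
    ultimately have "\<bar>(norm (\<Sum>j\<in>UNIV. v $ j *s column j B))\<^sup>2 -
        (\<Sum>j\<in>UNIV. (norm (v $ j *s column j B))\<^sup>2)\<bar> \<le> (real \<sigma> - 1) * \<nu> * (\<Sum>j\<in>UNIV. (norm (v $ j))\<^sup>2)"
      using assms(4) by (rule norm_sum_almost_orthogonal)
    then show ?thesis
      by (simp add: v matrix_mult_sum norm_vector_scale assms(1))
  qed
  \<comment> \<open>The criterion for the constant applies to nonnegative bounds only; 1 \<le>
    \<sigma> secures the sign.\<close>
  moreover have "0 \<le> (real \<sigma> - 1) * \<nu>"
    using assms by simp
  ultimately show ?thesis
    unfolding delta_def
    using restricted_isometry_const_le_iff_abs[OF bounded_linear_matrix_vector_mult] by blast
qed

theorem theorem3: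
  fixes A :: "'k::real_or_complex ^ ('N::finite \<times> 'n::finite) \<Rightarrow> 'k ^ 'm::finite"
    and s \<sigma> :: nat
  assumes "Vector_Spaces.linear (*s) (*s) A"
    and "s \<in> {1..CARD('N)}"
    and "\<sigma> \<in> {1..CARD('n)}"
  shows "((SUP i. delta \<sigma> (block_op A i)) \<le> block_delta 1 \<sigma> A \<and>
      sparse_block_coherence \<sigma> A \<le> 2 * block_delta 2 \<sigma> A) \<and>
    block_delta s \<sigma> A \<le>
      (SUP i. delta \<sigma> (block_op A i)) + (real s - 1) * sparse_block_coherence \<sigma> A \<and>
    ((\<forall>i j. norm (column j (block_op A i)) = 1) \<longrightarrow>
      block_delta s \<sigma> A \<le>
        (real \<sigma> - 1) * sub_coherence A + (real s - 1) * sparse_block_coherence \<sigma> A)"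
proof (intro conjI impI)
  have s: "1 \<le> s" and \<sigma>: "1 \<le> \<sigma>"
    using assms(2,3) by auto
  have upper: "delta \<sigma> (block_op A i) \<le> (SUP i. delta \<sigma> (block_op A i))" for i
    by (intro cSUP_upper bdd_above_finite) auto
  show "(SUP i. delta \<sigma> (block_op A i)) \<le> block_delta 1 \<sigma> A"
    by (intro cSUP_least delta_block_op_le[OF assms(1)]) auto
  show "sparse_block_coherence \<sigma> A \<le> 2 * block_delta 2 \<sigma> A"
    using sparse_block_coherence_le[OF assms(1), of \<sigma>] block_delta_nonneg[OF assms(1), of 2 \<sigma>]
    by simp
  show "block_delta s \<sigma> A \<le>
      (SUP i. delta \<sigma> (block_op A i)) + (real s - 1) * sparse_block_coherence \<sigma> A"
    \<comment> \<open>The supremum is nonnegative because it dominates a nonnegative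
      \<open>delta\<close>.\<close>
    by (rule block_delta_le[OF assms(1) s order_trans[OF delta_nonneg upper] upper])
  assume "\<forall>i j. norm (column j (block_op A i)) = 1"
  then have "delta \<sigma> (block_op A i) \<le> (real \<sigma> - 1) * sub_coherence A" for i
    by (intro delta_le_coherence norm_hinner_column_le_sub_coherence sub_coherence_nonneg \<sigma>) auto
  moreover have "0 \<le> (real \<sigma> - 1) * sub_coherence A"
    using \<sigma> by (simp add: sub_coherence_nonneg)
  ultimately show "block_delta s \<sigma> A \<le>
      (real \<sigma> - 1) * sub_coherence A + (real s - 1) * sparse_block_coherence \<sigma> A"
    by (intro block_delta_le[OF assms(1) s])
qed

end
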